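(* Let $M$ be any finitely generated abelian group. Then there exists a finite graph $G$ whose magnitude homology $\mathrm{MH}(G)=\bigoplus_{k,\ell\ge 0}\mathrm{MH}_{k,\ell}(G)$ contains a subgroup isomorphic to $M$.
   Context: All graphs are finite, undirected, with no loops and no multiple edges. For a graph $G$, $d(x,y)$ denotes the shortest-path distance (edges have length $1$; $\infty$ if no path). A $k$-path is a tuple $(x_0,\dots,x_k)$ of vertices with $x_i\neq x_{i+1}$ and $d(x_i,x_{i+1})<\infty$; its length is $\sum_i d(x_i,x_{i+1})$. $\mathrm{MC}_{k,\ell}(G)$ is the free abelian group on $k$-paths of length $\ell$, with differential $\partial=\sum_{i=1}^{k-1}(-1)^i\partial_i$, where $\partial_i$ deletes $x_i$ if the resulting tuple is a $(k-1)$-path of the same length $\ell$ and is $0$ otherwise; $\mathrm{MH}_{k,\ell}(G)=H_k(\mathrm{MC}_{*,\ell}(G))$. *)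

theory Defs
  imports "Graph_Theory.Graph_Theory" "HOL-Algebra.Algebra"
    "HOL-Algebra.Free_Abelian_Groups" "HOL-Algebra.Product_Groups"
begin

text \<open>
  Finite simple graphs are those \<open>G :: 'v pair_pre_digraph\<close> satisfying \<open>pair_graph G\<close>: each
  undirected edge is represented by the two arcs between its end points, and there are no loops.
  The shortest-path distance is the infimum of the costs of all walks when every arc has cost 1;
  it is \<open>\<infinity>\<close> if there is no walk.
\<close>

definition graph_dist :: "'v pair_pre_digraph \<Rightarrow> 'v \<Rightarrow> 'v \<Rightarrow> ereal" where
  "graph_dist G x y = wf_digraph.\<mu> (with_proj G) (\<lambda>_. 1) x y"

text \<open>A tuple \<open>(x\<^sub>0, \<dots>, x\<^sub>k)\<close> is a list of length \<open>k + 1\<close>.\<close>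

definition mag_path :: "'v pair_pre_digraph \<Rightarrow> nat \<Rightarrow> 'v list \<Rightarrow> bool" where
  "mag_path G k xs \<longleftrightarrow>
     length xs = Suc k \<and> set xs \<subseteq> pverts G \<and>
     (\<forall>i<k. xs ! i \<noteq> xs ! Suc i \<and> graph_dist G (xs ! i) (xs ! Suc i) < \<infinity>)"

definition mag_length :: "'v pair_pre_digraph \<Rightarrow> 'v list \<Rightarrow> ereal" where
  "mag_length G xs = (\<Sum>i<length xs - 1. graph_dist G (xs ! i) (xs ! Suc i))"

definition mag_paths :: "'v pair_pre_digraph \<Rightarrow> nat \<Rightarrow> nat \<Rightarrow> 'v list set" where
  "mag_paths G k l = {xs. mag_path G k xs \<and> mag_length G xs = ereal (real l)}"

definition mag_chain_group :: "'v pair_pre_digraph \<Rightarrow> nat \<Rightarrow> nat \<Rightarrow> ('v list \<Rightarrow>\<^sub>0 int) monoid" where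
  "mag_chain_group G k l = free_Abelian_group (mag_paths G k l)"

definition delete_nth :: "nat \<Rightarrow> 'v list \<Rightarrow> 'v list" where
  "delete_nth i xs = take i xs @ drop (Suc i) xs"

definition mag_face ::
    "'v pair_pre_digraph \<Rightarrow> nat \<Rightarrow> nat \<Rightarrow> nat \<Rightarrow> 'v list \<Rightarrow> ('v list \<Rightarrow>\<^sub>0 int)" where
  "mag_face G k l i xs =
     (if delete_nth i xs \<in> mag_paths G (k - 1) l then frag_of (delete_nth i xs) else 0)"

text \<open>
  The differential on \<open>MC\<^sub>k\<^sub>,\<^sub>l\<close>, extended linearly from \<open>k\<close>-paths. For \<open>k \<le> 1\<close> the
  alternating sum is empty, so the differential is zero, as it must be for \<open>k = 0\<close>.
\<close>

definition mag_boundary ::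
    "'v pair_pre_digraph \<Rightarrow> nat \<Rightarrow> nat \<Rightarrow> ('v list \<Rightarrow>\<^sub>0 int) \<Rightarrow> ('v list \<Rightarrow>\<^sub>0 int)" where
  "mag_boundary G k l =
     frag_extend (\<lambda>xs. \<Sum>i\<in>{1..<k}. frag_cmul ((-1) ^ i) (mag_face G k l i xs))"

definition mag_cycles :: "'v pair_pre_digraph \<Rightarrow> nat \<Rightarrow> nat \<Rightarrow> ('v list \<Rightarrow>\<^sub>0 int) set" where
  "mag_cycles G k l = {c \<in> carrier (mag_chain_group G k l). mag_boundary G k l c = 0}"

definition mag_boundaries :: "'v pair_pre_digraph \<Rightarrow> nat \<Rightarrow> nat \<Rightarrow> ('v list \<Rightarrow>\<^sub>0 int) set" where
  "mag_boundaries G k l = mag_boundary G (Suc k) l ` carrier (mag_chain_group G (Suc k) l)"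

definition mag_homology_group ::
    "'v pair_pre_digraph \<Rightarrow> nat \<Rightarrow> nat \<Rightarrow> ('v list \<Rightarrow>\<^sub>0 int) set monoid" where
  "mag_homology_group G k l =
     (mag_chain_group G k l)\<lparr>carrier := mag_cycles G k l\<rparr> Mod mag_boundaries G k l"

text \<open>The direct sum over all bidegrees; elements of \<open>sum_group\<close> have finite support.\<close>

definition magnitude_homology ::
    "'v pair_pre_digraph \<Rightarrow> (nat \<times> nat \<Rightarrow> ('v list \<Rightarrow>\<^sub>0 int) set) monoid" where
  "magnitude_homology G = sum_group UNIV (\<lambda>(k, l). mag_homology_group G k l)"

end

theory Submission
  imports Defs
begin

text \<open>
  Adding one generator at a time shows that \<open>M\<close> has a finite subset \<open>F\<close> containing \<open>\<one>\<close>, for which \<open>M\<close>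
  is generated by \<open>F\<close> subject only to the relations \<open>[a] + [b] = [a \<otimes> b]\<close> with \<open>a, b, a \<otimes> b \<in> F\<close>.
  Take the regular CW complex with three vertices \<open>0, 1, 2\<close>, an edge \<open>i \<rightarrow> j\<close> for every \<open>i < j\<close> and every
  element of \<open>F\<close>, and a triangle for every such relation; its first homology is \<open>M\<close>. In the Hasse diagram
  of its face poset with a bottom \<open>s\<close> and a top \<open>t\<close> added, the paths of length 4 from \<open>s\<close> to \<open>t\<close> are the
  flags of cells, so the part of \<open>MC\<^sub>*\<^sub>,\<^sub>4\<close> between \<open>s\<close> and \<open>t\<close> computes the homology of the complex, with the
  degree shifted by 2. The edge loops give a homomorphism from the free abelian group on \<open>F\<close> to \<open>MH\<^sub>3\<^sub>,\<^sub>4\<close>.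
  It kills the relations since these bound triangles, and nothing else since the labels of the edges
  form a cocycle with values in \<open>M\<close> that maps the loop of \<open>a\<close> back to \<open>a\<close>.
\<close>

section \<open>Presentations with three-term relations\<close>

lemma frag_cmul_diff_distrib2: "frag_cmul k (x - y) = frag_cmul k x - frag_cmul k y"
  by (rule poly_mapping_eqI) (simp add: lookup_minus right_diff_distrib)

text \<open>The subgroup of the free abelian group on \<open>F\<close> generated by the three-term
  relations. Closure under differences already yields negatives and sums, so inductions have only
  three cases.\<close>

inductive_set triangle_rels :: "('a, 'b) monoid_scheme \<Rightarrow> 'a set \<Rightarrow> ('a \<Rightarrow>\<^sub>0 int) set"
  for M :: "('a, 'b) monoid_scheme" and F :: "'a set" where
  zero: "0 \<in> triangle_rels M F"
| rel: "\<lbrakk>a \<in> F; b \<in> F; a \<otimes>\<^bsub>M\<^esub> b \<in> F\<rbrakk>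
    \<Longrightarrow> frag_of a + frag_of b - frag_of (a \<otimes>\<^bsub>M\<^esub> b) \<in> triangle_rels M F"
| diff: "\<lbrakk>x \<in> triangle_rels M F; y \<in> triangle_rels M F\<rbrakk> \<Longrightarrow> x - y \<in> triangle_rels M F"

lemma triangle_rels_minus: "x \<in> triangle_rels M F \<Longrightarrow> - x \<in> triangle_rels M F"
  using triangle_rels.diff[OF triangle_rels.zero] by fastforce

lemma triangle_rels_add:
  "\<lbrakk>x \<in> triangle_rels M F; y \<in> triangle_rels M F\<rbrakk> \<Longrightarrow> x + y \<in> triangle_rels M F"
  using triangle_rels.diff[OF _ triangle_rels_minus] by fastforce

lemma triangle_rels_cmul:
  assumes "x \<in> triangle_rels M F"
  shows "frag_cmul k x \<in> triangle_rels M F"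
proof -
  have *: "frag_cmul (int n) x \<in> triangle_rels M F" for n
    by (induction n) (auto simp: frag_cmul_distrib intro: triangle_rels.zero triangle_rels_add assms)
  show ?thesis
    by (cases k) (metis *, metis * triangle_rels_minus minus_frag_cmul)
qed

lemma triangle_rels_mono: "x \<in> triangle_rels M F \<Longrightarrow> F \<subseteq> F' \<Longrightarrow> x \<in> triangle_rels M F'"
proof (induction rule: triangle_rels.induct)
  case zero
  then show ?case by (intro triangle_rels.zero)
next
  case (rel a b)
  then show ?case by (intro triangle_rels.rel) auto
next
  case (diff x y)
  then show ?case by (intro triangle_rels.diff) auto
qed

lemma keys_triangle_rels: "x \<in> triangle_rels M F \<Longrightarrow> Poly_Mapping.keys x \<subseteq> F"
proof (induction rule: triangle_rels.induct)
  case (rel a b)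
  then show ?case
    using keys_diff[of "frag_of a + frag_of b" "frag_of (a \<otimes>\<^bsub>M\<^esub> b)"] keys_add[of "frag_of a" "frag_of b"]
    by (auto simp: keys_frag_of)
next
  case (diff x y)
  then show ?case using keys_diff[of x y] by auto
qed auto

section \<open>Evaluation of formal sums in an abelian group, and presentations\<close>

context comm_group
begin

text \<open>The canonical homomorphism that multiplies out a formal sum. The universal property
  gives only its existence, whence the choice; nothing is known about its values on sums not
  supported in the carrier, whence the hypotheses on keys below.\<close>

definition frag_eval :: "('a \<Rightarrow>\<^sub>0 int) \<Rightarrow> 'a" where
  "frag_eval = (SOME h. h \<in> hom (free_Abelian_group (carrier G)) G \<and>
     (\<forall>x \<in> carrier G. h (frag_of x) = x))"

lemma frag_eval_hom: "frag_eval \<in> hom (free_Abelian_group (carrier G)) G"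
  and frag_eval_of [simp]: "x \<in> carrier G \<Longrightarrow> frag_eval (frag_of x) = x"
proof -
  have "\<exists>h. h \<in> hom (free_Abelian_group (carrier G)) G \<and> (\<forall>x \<in> carrier G. h (frag_of x) = x)"
    using free_Abelian_group_universal[of "\<lambda>x. x" "carrier G"] by (metis image_ident order_refl)
  from someI_ex[OF this]
  show "frag_eval \<in> hom (free_Abelian_group (carrier G)) G"
    "x \<in> carrier G \<Longrightarrow> frag_eval (frag_of x) = x"
    unfolding frag_eval_def by auto
qed

lemma frag_eval_group_hom: "group_hom (free_Abelian_group (carrier G)) G frag_eval"
  by (simp add: group_hom_def group_hom_axioms_def frag_eval_hom is_group)

lemma frag_eval_closed [simp]: "Poly_Mapping.keys x \<subseteq> carrier G \<Longrightarrow> frag_eval x \<in> carrier G"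
  using group_hom.hom_closed[OF frag_eval_group_hom] by simp

lemma frag_eval_0 [simp]: "frag_eval 0 = \<one>"
  using group_hom.hom_one[OF frag_eval_group_hom] by simp

lemma frag_eval_add:
  assumes "Poly_Mapping.keys x \<subseteq> carrier G" "Poly_Mapping.keys y \<subseteq> carrier G"
  shows "frag_eval (x + y) = frag_eval x \<otimes> frag_eval y"
  using group_hom.hom_mult[OF frag_eval_group_hom, of x y] assms by simp

lemma frag_eval_minus:
  assumes "Poly_Mapping.keys x \<subseteq> carrier G"
  shows "frag_eval (- x) = inv (frag_eval x)"
  using group_hom.hom_inv[OF frag_eval_group_hom, of x] assms by simp

lemma frag_eval_diff:
  assumes "Poly_Mapping.keys x \<subseteq> carrier G" "Poly_Mapping.keys y \<subseteq> carrier G"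
  shows "frag_eval (x - y) = frag_eval x \<otimes> inv (frag_eval y)"
  using frag_eval_add[of x "- y"] assms by (simp add: frag_eval_minus)

lemma frag_eval_cmul:
  assumes "Poly_Mapping.keys x \<subseteq> carrier G"
  shows "frag_eval (frag_cmul k x) = frag_eval x [^] k"
  using group_hom.hom_int_pow[OF frag_eval_group_hom, of x k] assms by simp

lemma frag_eval_generate:
  assumes "F \<subseteq> carrier G" "Poly_Mapping.keys x \<subseteq> F"
  shows "frag_eval x \<in> generate G F"
proof (rule free_Abelian_group_induct[OF assms(2)])
  show "frag_eval 0 \<in> generate G F" by (simp add: generate.one)
next
  fix x y :: "'a \<Rightarrow>\<^sub>0 int"
  assume xy: "Poly_Mapping.keys x \<subseteq> F" "Poly_Mapping.keys y \<subseteq> F"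
    "frag_eval x \<in> generate G F" "frag_eval y \<in> generate G F"
  then have "frag_eval (x - y) = frag_eval x \<otimes> inv (frag_eval y)"
    using assms(1) by (intro frag_eval_diff) auto
  then show "frag_eval (x - y) \<in> generate G F"
    using generate.eng[OF xy(3) generate_m_inv_closed[OF assms(1) xy(4)]] by simp
next
  fix a assume "a \<in> F"
  moreover from this have "a \<in> carrier G" using assms(1) by auto
  ultimately show "frag_eval (frag_of a) \<in> generate G F" by (simp add: generate.incl)
qed

lemma frag_eval_triangle_rels:
  assumes "F \<subseteq> carrier G" "x \<in> triangle_rels G F"
  shows "frag_eval x = \<one>"
  using assms(2)
proof (induction rule: triangle_rels.induct)
  case zero
  show ?case by simp
next
  case (rel a b)
  then have [simp]: "a \<in> carrier G" "b \<in> carrier G" using assms(1) by auto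
  have "Poly_Mapping.keys (frag_of a + frag_of b) \<subseteq> carrier G"
    using keys_add[of "frag_of a" "frag_of b"] by (auto simp: keys_frag_of)
  then show ?case by (simp add: frag_eval_diff frag_eval_add)
next
  case (diff x y)
  have "Poly_Mapping.keys x \<subseteq> carrier G" "Poly_Mapping.keys y \<subseteq> carrier G"
    using keys_triangle_rels[OF diff(1)] keys_triangle_rels[OF diff(2)] assms(1) by auto
  then show ?case using diff by (simp add: frag_eval_diff)
qed

text \<open>The last clause says that the kernel of evaluation on sums over \<open>F\<close>
  consists of three-term relations. \<open>F\<close> may generate a proper subgroup, so
  presentations can be enlarged step by step.\<close>

definition presented_by :: "'a set \<Rightarrow> bool" where
  "presented_by F \<longleftrightarrow> finite F \<and> F \<subseteq> carrier G \<and> \<one> \<in> F \<and>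
     (\<forall>c. Poly_Mapping.keys c \<subseteq> F \<and> frag_eval c = \<one> \<longrightarrow> c \<in> triangle_rels G F)"

text \<open>Relations evaluate to \<open>\<one>\<close>. Subtracting one from \<open>c\<close>
  therefore keeps the value, and once the support lies in \<open>F\<close> the presentation over
  \<open>F\<close> applies.\<close>

lemma presented_by_extend:
  assumes F: "presented_by F" and F': "finite F'" "F \<subseteq> F'" "F' \<subseteq> carrier G"
    and red: "\<And>c. \<lbrakk>Poly_Mapping.keys c \<subseteq> F'; frag_eval c = \<one>\<rbrakk>
      \<Longrightarrow> \<exists>x \<in> triangle_rels G F'. Poly_Mapping.keys (c - x) \<subseteq> F"
  shows "presented_by F'"
  unfolding presented_by_def
proof (intro conjI allI impI)
  show "\<one> \<in> F'" using F F'(2) by (auto simp: presented_by_def)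
  fix c :: "'a \<Rightarrow>\<^sub>0 int"
  assume c: "Poly_Mapping.keys c \<subseteq> F' \<and> frag_eval c = \<one>"
  then obtain x where x: "x \<in> triangle_rels G F'" "Poly_Mapping.keys (c - x) \<subseteq> F"
    using red by blast
  have "Poly_Mapping.keys c \<subseteq> carrier G" "Poly_Mapping.keys x \<subseteq> carrier G"
    using c F'(3) keys_triangle_rels[OF x(1)] by auto
  then have "frag_eval (c - x) = \<one>"
    using c frag_eval_triangle_rels[OF F'(3) x(1)] by (simp add: frag_eval_diff)
  then have "c - x \<in> triangle_rels G F"
    using F x(2) by (simp add: presented_by_def)
  then show "c \<in> triangle_rels G F'"
    using triangle_rels_add[OF triangle_rels_mono[OF _ F'(2)] x(1), of "c - x"] by simp
qed (use F' in auto)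

text \<open>A Tietze move: up to sign, the new generator \<open>h\<close> has coefficient 1 in a
  single three-term relation over \<open>insert h F\<close>, so a multiple of that relation removes
  \<open>h\<close> from any formal sum.\<close>

lemma presented_by_insert:
  assumes F: "presented_by F" and u: "u \<in> F" and f: "f \<in> F" and h: "h \<in> carrier G"
    and rel: "h = u \<otimes> f \<or> u = h \<otimes> f"
  shows "presented_by (insert h F)"
proof (cases "h \<in> F")
  case True
  then show ?thesis using F by (simp add: insert_absorb)
next
  case False
  obtain x where x: "x \<in> triangle_rels G (insert h F)" "Poly_Mapping.lookup x h = 1"
  proof (cases "h = u \<otimes> f")
    case True
    have "- (frag_of u + frag_of f - frag_of (u \<otimes> f)) \<in> triangle_rels G (insert h F)"
      using u f True by (intro triangle_rels_minus triangle_rels.rel) auto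
    moreover have "Poly_Mapping.lookup (- (frag_of u + frag_of f - frag_of (u \<otimes> f))) h = (1::int)"
      using False u f True[symmetric] by (auto simp: lookup_add lookup_minus when_def)
    ultimately show ?thesis by (rule that)
  next
    case nt: False
    then have "h \<otimes> f = u" using rel by simp
    then have "frag_of h + frag_of f - frag_of u \<in> triangle_rels G (insert h F)"
      using triangle_rels.rel[of h "insert h F" f G] u f by simp
    moreover have "Poly_Mapping.lookup (frag_of h + frag_of f - frag_of u) h = (1::int)"
      using False u f by (auto simp: lookup_add lookup_minus when_def)
    ultimately show ?thesis by (rule that)
  qed
  show ?thesis
  proof (rule presented_by_extend[OF F])
    fix c :: "'a \<Rightarrow>\<^sub>0 int"
    assume c: "Poly_Mapping.keys c \<subseteq> insert h F"
    let ?x = "frag_cmul (Poly_Mapping.lookup c h) x"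
    have "Poly_Mapping.lookup (c - ?x) h = 0"
      using x(2) by (simp add: lookup_minus)
    then have "h \<notin> Poly_Mapping.keys (c - ?x)" by (simp add: in_keys_iff)
    moreover have "Poly_Mapping.keys (c - ?x) \<subseteq> insert h F"
      using keys_diff[of c ?x] keys_cmul[of "Poly_Mapping.lookup c h" x] keys_triangle_rels[OF x(1)] c
      by blast
    ultimately show "\<exists>x \<in> triangle_rels G (insert h F). Poly_Mapping.keys (c - x) \<subseteq> F"
      using triangle_rels_cmul[OF x(1)] by blast
  qed (use F h in \<open>auto simp: presented_by_def\<close>)
qed

text \<open>Follow the way in which \<open>m\<close> is built from \<open>F\<close>, inserting each
  intermediate element. The start set \<open>F0\<close> is generalised so that the second factor of
  a product can be handled on top of the set obtained for the first.\<close>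

lemma presented_by_adjoin:
  assumes "presented_by F" "m \<in> generate G F"
  shows "\<exists>F'. presented_by F' \<and> F \<subseteq> F' \<and> F' \<subseteq> generate G F \<and> m \<in> F'"
proof -
  have Fc: "F \<subseteq> carrier G" using assms(1) by (simp add: presented_by_def)
  have "\<exists>F'. presented_by F' \<and> F0 \<subseteq> F' \<and> F' \<subseteq> generate G F \<and> m \<in> F'"
    if "presented_by F0" "F \<subseteq> F0" "F0 \<subseteq> generate G F" for F0
    using assms(2) that
  proof (induction arbitrary: F0 rule: generate.induct)
    case one
    then show ?case by (intro exI[of _ F0]) (simp add: presented_by_def)
  next
    case (incl h)
    then show ?case by (intro exI[of _ F0]) (simp add: subset_iff)
  next
    case (inv h)
    \<comment> \<open>The inserted element enters through the relation
      \<open>inv h \<otimes> h = \<one>\<close>, which uses \<open>\<one> \<in> F0\<close>.\<close>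
    have "presented_by (insert (inv h) F0)"
      by (rule presented_by_insert[where u = \<one> and f = h])
        (use inv Fc in \<open>auto simp: presented_by_def\<close>)
    moreover have "inv h \<in> generate G F" using inv by (simp add: generate.inv)
    ultimately show ?case using inv by (intro exI[of _ "insert (inv h) F0"]) auto
  next
    case (eng h1 h2)
    from eng.IH(1)[OF eng.prems] obtain F1 where
      F1: "presented_by F1" "F0 \<subseteq> F1" "F1 \<subseteq> generate G F" "h1 \<in> F1" by blast
    have "F \<subseteq> F1" using F1(2) eng.prems by auto
    from eng.IH(2)[OF F1(1) this F1(3)] obtain F2 where
      F2: "presented_by F2" "F1 \<subseteq> F2" "F2 \<subseteq> generate G F" "h2 \<in> F2" by blast
    have "presented_by (insert (h1 \<otimes> h2) F2)"
      by (rule presented_by_insert[where u = h1 and f = h2])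
        (use F1 F2 generate_in_carrier[OF Fc] eng in auto)
    moreover have "h1 \<otimes> h2 \<in> generate G F" using eng by (simp add: generate.eng)
    ultimately show ?case using F1 F2 by (intro exI[of _ "insert (h1 \<otimes> h2) F2"]) auto
  qed
  moreover have "F \<subseteq> generate G F"
    by (rule subsetI) (rule generate.incl)
  ultimately show ?thesis using assms(1) order_refl by meson
qed

text \<open>The exponents that send \<open>g\<close> into \<open>H\<close> form an ideal of the
  integers, and \<open>d\<close> is its nonnegative generator. If no positive power lies in
  \<open>H\<close>, then \<open>d = 0\<close>, and divisibility by 0 forces
  \<open>b = 0\<close>.\<close>

lemma int_pow_mem_subgroup_multiples:
  assumes H: "subgroup H G" and g: "g \<in> carrier G"
  obtains d :: nat where "g [^] d \<in> H" "\<And>b::int. g [^] b \<in> H \<Longrightarrow> int d dvd b"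
proof (cases "\<exists>n::nat. n > 0 \<and> g [^] n \<in> H")
  case True
  define d where "d = (LEAST n::nat. n > 0 \<and> g [^] n \<in> H)"
  have d: "d > 0" "g [^] d \<in> H" using LeastI_ex[OF True] unfolding d_def by auto
  have dH: "g [^] (int d * q) \<in> H" for q
  proof -
    have "g [^] (int d * q) = (g [^] d) [^] q"
      using int_pow_pow[OF g, of "int d" q] by (simp only: int_pow_int)
    then show ?thesis using subgroup_int_pow_closed[OF H d(2)] by simp
  qed
  have "int d dvd b" if b: "g [^] b \<in> H" for b :: int
  proof (rule ccontr)
    assume "\<not> int d dvd b"
    then have "b mod int d \<noteq> 0" by (metis mod_0_imp_dvd)
    moreover have "0 \<le> b mod int d" "b mod int d < int d" using d(1) by simp_all
    ultimately have r: "b mod int d > 0" "b mod int d < int d" by linarith+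
    have "g [^] (b mod int d) = g [^] b \<otimes> inv (g [^] (int d * (b div int d)))"
      using int_pow_diff[OF g, of b "int d * (b div int d)"] by (simp only: minus_mult_div_eq_mod)
    also have "\<dots> \<in> H"
      using subgroup.m_closed[OF H b subgroup.m_inv_closed[OF H dH]] .
    finally have "g [^] int (nat (b mod int d)) \<in> H"
      using r by simp
    then have "g [^] nat (b mod int d) \<in> H" by (simp only: int_pow_int)
    then have "d \<le> nat (b mod int d)"
      using r Least_le[of "\<lambda>n. n > 0 \<and> g [^] n \<in> H" "nat (b mod int d)", folded d_def] by simp
    then show False using r by linarith
  qed
  then show ?thesis using that d(2) by blast
next
  case False
  have "b = 0" if b: "g [^] b \<in> H" for b :: int
  proof (rule ccontr)
    assume "b \<noteq> 0"
    have "g [^] (- b) \<in> H"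
      using subgroup.m_inv_closed[OF H b] int_pow_neg[OF g, of b] by (simp only:)
    then have "g [^] int (nat \<bar>b\<bar>) \<in> H"
      using b by (cases "b \<ge> 0") auto
    then have "g [^] nat \<bar>b\<bar> \<in> H" by (simp only: int_pow_int)
    moreover have "nat \<bar>b\<bar> > 0" using \<open>b \<noteq> 0\<close> by simp
    ultimately show False using False by blast
  qed
  then show ?thesis using that[of 0] subgroup.one_closed[OF H] by auto
qed


text \<open>Make \<open>g [^] d\<close> a member first, with \<open>d\<close> the generator of the
  exponents landing in the subgroup generated by \<open>F\<close>; then add the powers of
  \<open>g\<close> up to it. The relations between successive powers reduce a formal sum to one over
  \<open>F1\<close> plus \<open>b\<close> times \<open>g\<close>. If its value is
  \<open>\<one>\<close>, then \<open>d\<close> divides \<open>b\<close>, and the multiple of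
  \<open>g\<close> is traded for a multiple of \<open>g [^] d\<close>.\<close>

lemma presented_by_insert_generator:
  assumes F: "presented_by F" and g: "g \<in> carrier G"
  shows "\<exists>F'. presented_by F' \<and> insert g F \<subseteq> F'"
proof -
  have Fc: "F \<subseteq> carrier G" using F by (simp add: presented_by_def)
  obtain d :: nat where d: "g [^] d \<in> generate G F"
    "\<And>b::int. g [^] b \<in> generate G F \<Longrightarrow> int d dvd b"
    using int_pow_mem_subgroup_multiples[OF generate_is_subgroup[OF Fc] g] by blast
  obtain F1 where F1: "presented_by F1" "F \<subseteq> F1" "F1 \<subseteq> generate G F" "g [^] d \<in> F1"
    using presented_by_adjoin[OF F d(1)] by blast
  have F1c: "F1 \<subseteq> carrier G" "\<one> \<in> F1" using F1(1) by (auto simp: presented_by_def)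
  \<comment> \<open>The bound \<open>max d 1\<close> puts \<open>g\<close> itself into the set even
    when \<open>d = 0\<close>.\<close>
  define F2 where "F2 = F1 \<union> (\<lambda>i. g [^] i) ` {..max d 1}"
  have F2c: "F2 \<subseteq> carrier G" using F1c g by (auto simp: F2_def)
  have gF2: "g [^] i \<in> F2" if "i \<le> max d 1" for i using that by (simp add: F2_def)
  have "g \<in> F2" using gF2[of 1] g by simp
  have powrel: "frag_of (g [^] i) - frag_cmul (int i) (frag_of g) \<in> triangle_rels G F2"
    if "i \<le> max d 1" for i
    using that
  proof (induction i)
    case 0
    show ?case using triangle_rels.rel[of \<one> F2 \<one> G] gF2[of 0] by simp
  next
    case (Suc i)
    then have "frag_of (g [^] i) + frag_of g - frag_of (g [^] Suc i) \<in> triangle_rels G F2"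
      using triangle_rels.rel[of "g [^] i" F2 g G] gF2[of i] gF2[of "Suc i"] \<open>g \<in> F2\<close> by simp
    from triangle_rels.diff[OF Suc.IH this] Suc.prems show ?case
      by (simp add: frag_cmul_distrib algebra_simps)
  qed
  have red: "\<exists>x \<in> triangle_rels G F2. \<exists>b. Poly_Mapping.keys (c - x - frag_cmul b (frag_of g)) \<subseteq> F1"
    if "Poly_Mapping.keys c \<subseteq> F2" for c
  proof (rule free_Abelian_group_induct[OF that])
    show "\<exists>x \<in> triangle_rels G F2. \<exists>b. Poly_Mapping.keys (0 - x - frag_cmul b (frag_of g)) \<subseteq> F1"
      by (intro bexI[of _ 0] exI[of _ 0] triangle_rels.zero) simp
  next
    fix x y
    assume "\<exists>u \<in> triangle_rels G F2. \<exists>b. Poly_Mapping.keys (x - u - frag_cmul b (frag_of g)) \<subseteq> F1"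
      "\<exists>u \<in> triangle_rels G F2. \<exists>b. Poly_Mapping.keys (y - u - frag_cmul b (frag_of g)) \<subseteq> F1"
    then obtain u v b b' where uv: "u \<in> triangle_rels G F2" "v \<in> triangle_rels G F2"
      "Poly_Mapping.keys (x - u - frag_cmul b (frag_of g)) \<subseteq> F1"
      "Poly_Mapping.keys (y - v - frag_cmul b' (frag_of g)) \<subseteq> F1" by blast
    have eq: "x - y - (u - v) - frag_cmul (b - b') (frag_of g) =
      (x - u - frag_cmul b (frag_of g)) - (y - v - frag_cmul b' (frag_of g))"
    proof -
      have "x - y - (u - v) - (p - p') = (x - u - p) - (y - v - p')" for p p' by simp
      then show ?thesis by (simp only: frag_cmul_diff_distrib)
    qed
    have "Poly_Mapping.keys (x - y - (u - v) - frag_cmul (b - b') (frag_of g)) \<subseteq> F1"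
      unfolding eq by (rule order_trans[OF keys_diff Un_least[OF uv(3,4)]])
    then show "\<exists>u \<in> triangle_rels G F2. \<exists>b. Poly_Mapping.keys (x - y - u - frag_cmul b (frag_of g)) \<subseteq> F1"
      using triangle_rels.diff[OF uv(1,2)] by blast
  next
    fix a assume "a \<in> F2"
    then consider "a \<in> F1" | i where "i \<le> max d 1" "a = g [^] i" by (auto simp: F2_def)
    then show "\<exists>u \<in> triangle_rels G F2. \<exists>b. Poly_Mapping.keys (frag_of a - u - frag_cmul b (frag_of g)) \<subseteq> F1"
    proof cases
      case 1
      then show ?thesis by (intro bexI[of _ 0] exI[of _ 0] triangle_rels.zero) simp
    next
      case 2
      then show ?thesis by (intro bexI[OF _ powrel[OF 2(1)]] exI[of _ "int i"]) simp
    qed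
  qed
  have "presented_by F2"
  proof (rule presented_by_extend[OF F1(1)])
    show "finite F2" "F1 \<subseteq> F2" using F1(1) by (auto simp: F2_def presented_by_def)
    fix c :: "'a \<Rightarrow>\<^sub>0 int"
    assume c: "Poly_Mapping.keys c \<subseteq> F2" "frag_eval c = \<one>"
    obtain x b where x: "x \<in> triangle_rels G F2"
      and b: "Poly_Mapping.keys (c - x - frag_cmul b (frag_of g)) \<subseteq> F1"
      using red[OF c(1)] by blast
    define e where "e = c - x - frag_cmul b (frag_of g)"
    have keys: "Poly_Mapping.keys e \<subseteq> carrier G" "Poly_Mapping.keys c \<subseteq> carrier G"
      "Poly_Mapping.keys x \<subseteq> carrier G" "Poly_Mapping.keys (frag_cmul b (frag_of g)) \<subseteq> carrier G"
      using b F1c c(1) F2c keys_triangle_rels[OF x] g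
      by (auto simp: e_def keys_frag_of dest!: subsetD[OF keys_cmul])
    have "frag_eval c = frag_eval (e + frag_cmul b (frag_of g) + x)"
      by (simp add: e_def)
    also have "\<dots> = frag_eval e \<otimes> g [^] b"
      using keys frag_eval_triangle_rels[OF F2c x] g
        order_trans[OF keys_add[of e "frag_cmul b (frag_of g)"] Un_least[OF keys(1,4)]]
      by (simp add: frag_eval_add frag_eval_cmul keys_frag_of)
    \<comment> \<open>As \<open>e\<close> is supported in \<open>F1\<close>, this places
      \<open>g [^] b\<close> in the subgroup generated by \<open>F\<close>, where the choice of
      \<open>d\<close> applies.\<close>
    finally have "g [^] b = inv (frag_eval e)"
      using c(2) keys(1) g by (metis frag_eval_closed inv_equality int_pow_closed m_comm)
    moreover have "frag_eval e \<in> generate G F1"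
      using frag_eval_generate[OF F1c(1)] b by (simp add: e_def)
    moreover have "generate G F1 \<subseteq> generate G F"
      using generate_subgroup_incl[OF F1(3) generate_is_subgroup[OF Fc]] .
    ultimately have "g [^] b \<in> generate G F"
      using generate_m_inv_closed[OF Fc] by auto
    then obtain q where q: "b = int d * q" using d(2) by blast
    \<comment> \<open>The added relation says that \<open>g [^] d\<close> is \<open>d\<close> times
      \<open>g\<close>; taken \<open>q\<close> times it cancels the remaining \<open>b\<close>
      copies of \<open>g\<close>.\<close>
    let ?x = "x - frag_cmul q (frag_of (g [^] d) - frag_cmul (int d) (frag_of g))"
    have eq: "c - ?x = e + frag_cmul q (frag_of (g [^] d))"
    proof -
      have "c - (x - (p - p')) = c - x - p' + p" for p p' by simp
      then show ?thesis by (simp only: e_def q frag_cmul_diff_distrib2 frag_cmul_cmul mult.commute)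
    qed
    have "Poly_Mapping.keys (frag_cmul q (frag_of (g [^] d))) \<subseteq> F1"
      using F1(4) keys_cmul by (force simp: keys_frag_of)
    then have "Poly_Mapping.keys (c - ?x) \<subseteq> F1"
      unfolding eq by (intro order_trans[OF keys_add] Un_least b[folded e_def])
    moreover have "?x \<in> triangle_rels G F2"
      by (intro triangle_rels.diff x triangle_rels_cmul powrel) simp
    ultimately show "\<exists>x \<in> triangle_rels G F2. Poly_Mapping.keys (c - x) \<subseteq> F1" by blast
  qed (rule F2c)
  moreover have "insert g F \<subseteq> F2" using \<open>g \<in> F2\<close> F1(2) by (auto simp: F2_def)
  ultimately show ?thesis by blast
qed

lemma finitely_generated_presented:
  assumes "finite S" "S \<subseteq> carrier G"
  shows "\<exists>F. presented_by F \<and> S \<subseteq> F"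
  using assms
proof (induction S rule: finite_induct)
  case empty
  \<comment> \<open>The relation for \<open>\<one> \<otimes> \<one> = \<one>\<close> is
    \<open>frag_of \<one>\<close> itself, so every formal sum over this set is a relation.\<close>
  have "c \<in> triangle_rels G {\<one>}" if "Poly_Mapping.keys c \<subseteq> {\<one>}" for c
  proof (rule free_Abelian_group_induct[OF that])
    fix a assume "a \<in> {\<one>}"
    then show "frag_of a \<in> triangle_rels G {\<one>}"
      using triangle_rels.rel[of \<one> "{\<one>}" \<one> G] by simp
  qed (auto intro: triangle_rels.intros)
  then show ?case by (intro exI[of _ "{\<one>}"]) (simp add: presented_by_def)
next
  case (insert g S)
  then obtain F where "presented_by F" "S \<subseteq> F" by auto
  moreover have "g \<in> carrier G" using insert by simp
  ultimately show ?case using presented_by_insert_generator by (metis insert_mono order_trans)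
qed

end

section \<open>Distances in ranked graphs\<close>

context pair_graph
begin

lemma awalk_cost_one: "awalk_cost (\<lambda>_. 1) p = real (length p)"
  by (induction p) auto

lemma graph_dist_geI:
  assumes "\<And>p. awalk x p y \<Longrightarrow> b \<le> real (length p)"
  shows "ereal b \<le> graph_dist G x y"
  unfolding graph_dist_def \<mu>_def
  by (rule INF_greatest) (use assms in \<open>auto simp: awalk_cost_one\<close>)

lemma graph_dist_nonneg: "0 \<le> graph_dist G x y"
  using graph_dist_geI[of x y 0] by (simp add: zero_ereal_def)

lemma graph_dist_ge_1:
  assumes "x \<noteq> y"
  shows "1 \<le> graph_dist G x y"
  unfolding one_ereal_def
proof (rule graph_dist_geI)
  fix p assume "awalk x p y"
  then have "p \<noteq> []" using assms by (auto simp: awalk_def)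
  then show "1 \<le> real (length p)" by (cases p) auto
qed

text \<open>The distance is an infimum, so some walk costs less than 2; between distinct vertices it
  is a single arc.\<close>

lemma graph_dist_less_2:
  assumes "x \<noteq> y" "graph_dist G x y < 2"
  shows "(x, y) \<in> parcs G"
proof -
  obtain p where p: "awalk x p y" "real (length p) < 2"
    using assms(2) unfolding graph_dist_def \<mu>_def
    by (auto simp: INF_less_iff awalk_cost_one numeral_eq_ereal)
  then have "length p < 2" by simp
  then show ?thesis using p(1) assms(1)
    by (cases p) (auto simp: awalk_def)
qed

lemma graph_dist_arc: "(y, z) \<in> parcs G \<Longrightarrow> graph_dist G x z \<le> graph_dist G x y + 1"
  using pos_cost_mu_triangle[of "\<lambda>_. 1" "(y, z)" y z x]
  by (simp add: graph_dist_def arc_to_ends_def one_ereal_def)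

lemma graph_dist_self: "x \<in> pverts G \<Longrightarrow> graph_dist G x x = 0"
  using min_cost_le_walk_cost[of x "[]" x "\<lambda>_. 1"] graph_dist_nonneg[of x x]
  by (simp add: awalk_Nil_iff graph_dist_def zero_ereal_def)

end

locale ranked_graph = pair_graph +
  fixes r :: "'a \<Rightarrow> int"
  assumes rank_arc: "(x, y) \<in> parcs G \<Longrightarrow> r y = r x + 1 \<or> r y = r x - 1"
begin

lemma rank_awalk: "awalk x p y \<Longrightarrow> r y - r x \<le> int (length p)"
proof (induction p arbitrary: x)
  case Nil
  then show ?case by (simp add: awalk_Nil_iff)
next
  case (Cons e p)
  then have "e \<in> parcs G" "x = fst e" "awalk (snd e) p y" by (auto simp: awalk_Cons_iff)
  with Cons.IH[of "snd e"] rank_arc[of "fst e" "snd e"] show ?case by auto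
qed

lemma rank_le_graph_dist: "ereal (real_of_int (r y - r x)) \<le> graph_dist G x y"
proof (rule graph_dist_geI)
  fix p assume "awalk x p y"
  from rank_awalk[OF this] show "real_of_int (r y - r x) \<le> real (length p)" by linarith
qed

definition cover :: "'a \<Rightarrow> 'a \<Rightarrow> bool" where
  "cover x y \<longleftrightarrow> (x, y) \<in> parcs G \<and> r y = r x + 1"

text \<open>Saturated chains are geodesics: the chain bounds the distance above by \<open>n\<close>,
  and the rank difference bounds it below, since an arc raises the rank by at most one.\<close>

lemma graph_dist_cover_chain: "(cover ^^ n) x y \<Longrightarrow> x \<in> pverts G \<Longrightarrow>
  r y = r x + int n \<and> y \<in> pverts G \<and> graph_dist G x y = ereal (real n)"
proof (induction n arbitrary: y)
  case 0
  then show ?case by (simp add: graph_dist_self zero_ereal_def)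
next
  case (Suc n)
  then obtain z where z: "(cover ^^ n) x z" "cover z y" by auto
  have IH: "r z = r x + int n" "graph_dist G x z = ereal (real n)" using Suc z(1) by auto
  have r: "r y = r x + int (Suc n)" "y \<in> pverts G"
    using IH z(2) by (auto simp: cover_def dest: in_arcsD2)
  have "graph_dist G x y \<le> ereal (real n) + 1"
    using graph_dist_arc[of z y x] z(2) IH(2) by (simp add: cover_def)
  moreover have "ereal (real (Suc n)) \<le> graph_dist G x y"
    using rank_le_graph_dist[of y x] r(1) by simp
  ultimately show ?case using r by (simp add: one_ereal_def add.commute antisym)
qed

end

section \<open>Flags from bottom to top as magnitude chains\<close>

locale layered_graph = ranked_graph +
  fixes s t :: 'a
  assumes bot_vert: "s \<in> pverts G" and rank_bot: "r s = 0" and rank_top: "r t = 4"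
begin

definition flag :: "'a \<Rightarrow> 'a \<Rightarrow> 'a \<Rightarrow> bool" where
  "flag a b c \<longleftrightarrow> cover s a \<and> cover a b \<and> cover b c \<and> cover c t"

lemma
  assumes "flag a b c"
  shows flag_verts: "a \<in> pverts G" "b \<in> pverts G" "c \<in> pverts G" "t \<in> pverts G"
    and flag_dist: "graph_dist G s a = 1" "graph_dist G s b = 2" "graph_dist G s c = 3"
      "graph_dist G a b = 1" "graph_dist G a c = 2" "graph_dist G a t = 3"
      "graph_dist G b c = 1" "graph_dist G b t = 2" "graph_dist G c t = 1"
    and flag_rank: "r a = 1" "r b = 2" "r c = 3"
proof -
  have c: "(cover ^^ 1) s a" "(cover ^^ 2) s b" "(cover ^^ 3) s c"
    "(cover ^^ 1) a b" "(cover ^^ 2) a c" "(cover ^^ 3) a t"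
    "(cover ^^ 1) b c" "(cover ^^ 2) b t" "(cover ^^ 1) c t"
    using assms by (auto simp: flag_def numeral_2_eq_2 numeral_3_eq_3 relcompp_apply)
  show v: "a \<in> pverts G" "b \<in> pverts G" "c \<in> pverts G" "t \<in> pverts G"
    using assms by (auto simp: flag_def cover_def dest: in_arcsD2)
  show "graph_dist G s a = 1" "graph_dist G s b = 2" "graph_dist G s c = 3"
      "graph_dist G a b = 1" "graph_dist G a c = 2" "graph_dist G a t = 3"
      "graph_dist G b c = 1" "graph_dist G b t = 2" "graph_dist G c t = 1"
    using c[THEN graph_dist_cover_chain] v bot_vert
    by (simp_all add: one_ereal_def numeral_eq_ereal)
  show "r a = 1" "r b = 2" "r c = 3"
    using assms rank_bot by (auto simp: flag_def cover_def)
qed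

lemma flag_distinct:
  assumes "flag a b c"
  shows "s \<noteq> a" "s \<noteq> b" "s \<noteq> c" "a \<noteq> b" "a \<noteq> c" "b \<noteq> c" "a \<noteq> t" "b \<noteq> t" "c \<noteq> t"
  using flag_rank[OF assms] rank_bot rank_top by auto

text \<open>Distances along a flag equal rank differences, so deleting inner vertices leaves the
  total length at 4.\<close>

lemma flag_paths:
  assumes "flag a b c"
  shows "[s, a, b, c, t] \<in> mag_paths G 4 4"
    "[s, b, c, t] \<in> mag_paths G 3 4" "[s, a, c, t] \<in> mag_paths G 3 4" "[s, a, b, t] \<in> mag_paths G 3 4"
    "[s, a, t] \<in> mag_paths G 2 4" "[s, b, t] \<in> mag_paths G 2 4" "[s, c, t] \<in> mag_paths G 2 4"
  using flag_verts[OF assms] flag_dist[OF assms] flag_distinct[OF assms] bot_vert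
  by (auto simp: mag_paths_def mag_path_def mag_length_def less_Suc_eq numeral_eq_Suc lessThan_Suc
      one_ereal_def)

text \<open>By \<open>flag_paths\<close> no face is lost, so these are full simplicial boundaries
  with the end points fixed.\<close>

lemma flag_boundary:
  assumes "flag a b c"
  shows "mag_boundary G 4 4 (frag_of [s, a, b, c, t]) =
     frag_of [s, a, c, t] - frag_of [s, b, c, t] - frag_of [s, a, b, t]"
    and "mag_boundary G 3 4 (frag_of [s, a, b, t]) = frag_of [s, a, t] - frag_of [s, b, t]"
proof -
  have "{1..<4::nat} = {1, 2, 3}" "{1..<3::nat} = {1, 2}" by auto
  then show "mag_boundary G 4 4 (frag_of [s, a, b, c, t]) =
     frag_of [s, a, c, t] - frag_of [s, b, c, t] - frag_of [s, a, b, t]"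
    and "mag_boundary G 3 4 (frag_of [s, a, b, t]) = frag_of [s, a, t] - frag_of [s, b, t]"
    using flag_paths[OF assms]
    by (simp_all add: mag_boundary_def mag_face_def delete_nth_def numeral_eq_Suc)
qed

text \<open>Four steps of length at least 1 add up to 4, so each is shorter than 2 and hence an arc.
  To get from rank 0 to rank 4, every one of these arcs must go up.\<close>

lemma path_4_4_flag:
  assumes "xs \<in> mag_paths G 4 4" "xs ! 0 = s" "xs ! 4 = t"
  obtains a b c where "xs = [s, a, b, c, t]" "flag a b c"
proof -
  have "length xs = 5" using assms by (simp add: mag_paths_def mag_path_def)
  then obtain a b c where xs: "xs = [s, a, b, c, t]"
    using assms(2,3) by (auto simp: length_Suc_conv numeral_eq_Suc)
  have ne: "s \<noteq> a" "a \<noteq> b" "b \<noteq> c" "c \<noteq> t"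
    and fin: "graph_dist G s a < \<infinity>" "graph_dist G a b < \<infinity>" "graph_dist G b c < \<infinity>" "graph_dist G c t < \<infinity>"
    and len: "graph_dist G s a + graph_dist G a b + graph_dist G b c + graph_dist G c t = 4"
    using assms(1)
    by (auto simp: xs mag_paths_def mag_path_def mag_length_def less_Suc_eq numeral_eq_Suc lessThan_Suc
      one_ereal_def add_ac all_conj_distrib)
  note ge = ne[THEN graph_dist_ge_1]
  have "\<exists>d. graph_dist G x y = ereal d" if "1 \<le> graph_dist G x y" "graph_dist G x y < \<infinity>" for x y
    using that by (cases "graph_dist G x y") auto
  then obtain d1 d2 d3 d4 where d: "graph_dist G s a = ereal d1" "graph_dist G a b = ereal d2"
    "graph_dist G b c = ereal d3" "graph_dist G c t = ereal d4" using ge fin by metis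
  have "d1 < 2 \<and> d2 < 2 \<and> d3 < 2 \<and> d4 < 2"
    using ge len unfolding d by (simp add: one_ereal_def numeral_eq_ereal)
  then have "(s, a) \<in> parcs G" "(a, b) \<in> parcs G" "(b, c) \<in> parcs G" "(c, t) \<in> parcs G"
    using ne d by (auto intro!: graph_dist_less_2 simp: numeral_eq_ereal)
  moreover from this[THEN rank_arc] have "r a = r s + 1" "r b = r a + 1" "r c = r b + 1" "r t = r c + 1"
    using rank_bot rank_top by presburger+
  ultimately have "flag a b c" by (simp add: flag_def cover_def)
  with xs show ?thesis using that by blast
qed

end

section \<open>Magnitude chains and homology groups\<close>

lemma comm_group_mag_chain_group: "comm_group (mag_chain_group G k l)"
  by (simp add: mag_chain_group_def abelian_free_Abelian_group)

lemma group_mag_chain_group: "group (mag_chain_group G k l)"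
  by (simp add: mag_chain_group_def)

lemma mag_boundary_0 [simp]: "mag_boundary G k l 0 = 0"
  and mag_boundary_add: "mag_boundary G k l (x + y) = mag_boundary G k l x + mag_boundary G k l y"
  and mag_boundary_minus: "mag_boundary G k l (- x) = - mag_boundary G k l x"
  and mag_boundary_diff: "mag_boundary G k l (x - y) = mag_boundary G k l x - mag_boundary G k l y"
  by (simp_all add: mag_boundary_def frag_extend_add frag_extend_minus frag_extend_diff)

lemma mag_boundary_hom:
  "mag_boundary G (Suc k) l \<in> hom (mag_chain_group G (Suc k) l) (mag_chain_group G k l)"
proof (rule homI)
  fix x y
  show "mag_boundary G (Suc k) l (x \<otimes>\<^bsub>mag_chain_group G (Suc k) l\<^esub> y) =
    mag_boundary G (Suc k) l x \<otimes>\<^bsub>mag_chain_group G k l\<^esub> mag_boundary G (Suc k) l y"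
    by (simp add: mag_chain_group_def mag_boundary_add)
next
  fix x assume "x \<in> carrier (mag_chain_group G (Suc k) l)"
  have face: "mag_face G (Suc k) l i xs \<in> carrier (mag_chain_group G k l)" for i xs
    by (auto simp: mag_face_def mag_chain_group_def keys_frag_of)
  have "(\<Sum>i\<in>{1..<Suc k}. frag_cmul ((-1) ^ i) (mag_face G (Suc k) l i xs)) \<in> carrier (mag_chain_group G k l)" for xs
    unfolding mag_chain_group_def
    by (rule sum_closed_free_Abelian_group) (use face[unfolded mag_chain_group_def] in auto)
  then show "mag_boundary G (Suc k) l x \<in> carrier (mag_chain_group G k l)"
    unfolding mag_boundary_def mag_chain_group_def carrier_free_Abelian_group_iff
    by (intro order_trans[OF keys_frag_extend] UN_least)
qed

lemma subgroup_mag_boundaries: "subgroup (mag_boundaries G k l) (mag_chain_group G k l)"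
  unfolding mag_boundaries_def
  by (rule group_hom.img_is_subgroup)
    (simp add: group_hom_def group_hom_axioms_def mag_boundary_hom group_mag_chain_group)

lemma mag_boundaries_diff:
  assumes "x \<in> mag_boundaries G k l" "y \<in> mag_boundaries G k l"
  shows "x - y \<in> mag_boundaries G k l"
proof -
  obtain p q where pq: "p \<in> carrier (mag_chain_group G (Suc k) l)" "q \<in> carrier (mag_chain_group G (Suc k) l)"
    "x = mag_boundary G (Suc k) l p" "y = mag_boundary G (Suc k) l q"
    using assms by (auto simp: mag_boundaries_def)
  have "p - q \<in> carrier (mag_chain_group G (Suc k) l)"
    using pq(1,2) unfolding mag_chain_group_def carrier_free_Abelian_group_iff
    by (intro order_trans[OF keys_diff] Un_least)
  then show ?thesis unfolding mag_boundaries_def pq(3,4) mag_boundary_diff[symmetric] by (rule imageI)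
qed

lemma mag_boundaries_add:
  assumes "x \<in> mag_boundaries G k l" "y \<in> mag_boundaries G k l"
  shows "x + y \<in> mag_boundaries G k l"
  \<comment> \<open>The sum is written as \<open>x - ((y - y) - y)\<close>.\<close>
  using mag_boundaries_diff[OF assms(1) mag_boundaries_diff[OF mag_boundaries_diff[OF assms(2,2)] assms(2)]]
  by simp

lemma subgroup_mag_cycles: "subgroup (mag_cycles G k l) (mag_chain_group G k l)"
proof -
  have "Poly_Mapping.keys (x + y) \<subseteq> P" if "Poly_Mapping.keys x \<subseteq> P" "Poly_Mapping.keys y \<subseteq> P"
    for x y :: "'a list \<Rightarrow>\<^sub>0 int" and P
    using that by (intro order_trans[OF keys_add] Un_least)
  then show ?thesis
    by unfold_locales (auto simp: mag_cycles_def mag_chain_group_def mag_boundary_add mag_boundary_minus)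
qed

text \<open>A subgroup of chains modulo boundaries: in this form the group axioms do not depend on \<open>\<partial> \<circ> \<partial> = 0\<close>.\<close>

lemma mag_homology_group_eq:
  "mag_homology_group G k l = (mag_chain_group G k l Mod mag_boundaries G k l)
     \<lparr>carrier := (\<lambda>c. mag_boundaries G k l #>\<^bsub>mag_chain_group G k l\<^esub> c) ` mag_cycles G k l\<rparr>"
  by (auto simp: mag_homology_group_def FactGroup_def RCOSETS_def r_coset_def set_mult_def fun_eq_iff)

lemma mag_boundaries_normal: "mag_boundaries G k l \<lhd> mag_chain_group G k l"
  by (simp add: comm_group.normal_iff_subgroup comm_group_mag_chain_group subgroup_mag_boundaries)

lemma mag_coset_group_hom:
  "group_hom (mag_chain_group G k l) (mag_chain_group G k l Mod mag_boundaries G k l)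
     (\<lambda>c. mag_boundaries G k l #>\<^bsub>mag_chain_group G k l\<^esub> c)"
  unfolding group_hom_def group_hom_axioms_def
  by (intro conjI group_mag_chain_group normal.factorgroup_is_group normal.r_coset_hom_Mod
      mag_boundaries_normal)

lemma group_mag_homology_group: "group (mag_homology_group G k l)"
  unfolding mag_homology_group_eq
  using group_hom.subgroup_img_is_subgroup[OF mag_coset_group_hom subgroup_mag_cycles]
    group_hom.axioms(2)[OF mag_coset_group_hom]
  by (rule subgroup.subgroup_is_group)

lemma mag_class_hom:
  assumes "h \<in> hom F (mag_chain_group G k l)" "h ` carrier F \<subseteq> mag_cycles G k l"
  shows "(\<lambda>x. mag_boundaries G k l #>\<^bsub>mag_chain_group G k l\<^esub> h x) \<in> hom F (mag_homology_group G k l)"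
proof (rule homI)
  fix x y assume "x \<in> carrier F" "y \<in> carrier F"
  then show "mag_boundaries G k l #>\<^bsub>mag_chain_group G k l\<^esub> h (x \<otimes>\<^bsub>F\<^esub> y) =
    (mag_boundaries G k l #>\<^bsub>mag_chain_group G k l\<^esub> h x) \<otimes>\<^bsub>mag_homology_group G k l\<^esub>
    (mag_boundaries G k l #>\<^bsub>mag_chain_group G k l\<^esub> h y)"
    using group_hom.hom_mult[OF mag_coset_group_hom, of "h x" G k l "h y"]
      hom_in_carrier[OF assms(1)] hom_mult[OF assms(1)]
    by (simp add: mag_homology_group_eq)
qed (use assms(2) in \<open>auto simp: mag_homology_group_eq\<close>)

section \<open>Maps into the direct sum and out of the chain groups\<close>

lemma sum_group_single_hom:
  assumes "\<And>i. i \<in> I \<Longrightarrow> group (A i)" "j \<in> I"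
  shows "(\<lambda>x. \<lambda>i\<in>I. if i = j then x else \<one>\<^bsub>A i\<^esub>) \<in> hom (A j) (sum_group I A)"
proof (rule homI)
  fix x assume "x \<in> carrier (A j)"
  moreover have "finite {i \<in> I. (\<lambda>i\<in>I. if i = j then x else \<one>\<^bsub>A i\<^esub>) i \<noteq> \<one>\<^bsub>A i\<^esub>}"
    by (rule finite_subset[of _ "{j}"]) auto
  ultimately show "(\<lambda>i\<in>I. if i = j then x else \<one>\<^bsub>A i\<^esub>) \<in> carrier (sum_group I A)"
    using assms by (auto simp: carrier_sum_group group.is_monoid monoid.one_closed)
qed (use assms in \<open>auto simp: fun_eq_iff restrict_def group.is_monoid monoid.l_one monoid.one_closed\<close>)

text \<open>The image of \<open>f\<close> and the group \<open>M\<close> are both the quotient of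
  \<open>F\<close> by the common kernel. Hence no map from \<open>M\<close> into the homology has to
  be constructed.\<close>

lemma subgroup_iso_of_kernel_eq:
  assumes f: "group_hom F H f" and g: "group_hom F M g" and surj: "g ` carrier F = carrier M"
    and ker: "kernel F H f = kernel F M g"
  shows "\<exists>K. subgroup K H \<and> H\<lparr>carrier := K\<rparr> \<cong> M"
proof -
  let ?K = "f ` carrier F"
  have K: "subgroup ?K H" by (rule group_hom.img_is_subgroup[OF f])
  have "group_hom F (H\<lparr>carrier := ?K\<rparr>) f"
    using f subgroup.subgroup_is_group[OF K]
    by (auto simp: group_hom_def group_hom_axioms_def hom_def)
  from group_hom.FactGroup_iso[OF this] have "F Mod kernel F H f \<cong> H\<lparr>carrier := ?K\<rparr>"
    by (simp add: kernel_def)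
  moreover have "F Mod kernel F H f \<cong> M"
    using group_hom.FactGroup_iso[OF g surj] ker by simp
  ultimately have "H\<lparr>carrier := ?K\<rparr> \<cong> M"
    using group.iso_sym iso_trans normal.factorgroup_is_group[OF group_hom.normal_kernel[OF f]] by blast
  with K show ?thesis by blast
qed

text \<open>Extend \<open>w\<close> linearly, with value \<open>\<one>\<close> on paths that do not
  run from \<open>s\<close> to \<open>t\<close>. The differential keeps end points, so a generator
  either is a flag, where the cocycle identity applies, or has only faces of trivial value.\<close>

lemma (in layered_graph) cocycle_hom:
  assumes M: "comm_group M" and w: "\<And>x y. w x y \<in> carrier M"
    and cocycle: "\<And>a b c. flag a b c \<Longrightarrow> w a c = w a b \<otimes>\<^bsub>M\<^esub> w b c"
  obtains h where "h \<in> hom (mag_chain_group G 3 4) M"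
    "\<And>x y. [s, x, y, t] \<in> mag_paths G 3 4 \<Longrightarrow> h (frag_of [s, x, y, t]) = w x y"
    "\<And>c. c \<in> mag_boundaries G 3 4 \<Longrightarrow> h c = \<one>\<^bsub>M\<^esub>"
proof -
  interpret M: comm_group M by (rule M)
  let ?f = "\<lambda>xs. if xs ! 0 = s \<and> xs ! 3 = t then w (xs ! 1) (xs ! 2) else \<one>\<^bsub>M\<^esub>"
  obtain h where h: "h \<in> hom (mag_chain_group G 3 4) M"
    and hf: "\<And>xs. xs \<in> mag_paths G 3 4 \<Longrightarrow> h (frag_of xs) = ?f xs"
    using M.free_Abelian_group_universal[of ?f "mag_paths G 3 4"] w
    unfolding mag_chain_group_def by (smt (verit) M.one_closed image_subsetI)
  interpret h: group_hom "mag_chain_group G 3 4" M h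
    using h by (simp add: group_hom_def group_hom_axioms_def mag_chain_group_def)
  have [simp]: "carrier (mag_chain_group G 3 4) = {c. Poly_Mapping.keys c \<subseteq> mag_paths G 3 4}"
    by (auto simp: mag_chain_group_def)
  have h0: "h 0 = \<one>\<^bsub>M\<^esub>" using h.hom_one by (simp add: mag_chain_group_def)
  have hm: "h (- x) = inv\<^bsub>M\<^esub> h x" if "Poly_Mapping.keys x \<subseteq> mag_paths G 3 4" for x
    using h.hom_inv[of x] that by (simp add: mag_chain_group_def)
  have ha: "h (x + y) = h x \<otimes>\<^bsub>M\<^esub> h y"
    if "Poly_Mapping.keys x \<subseteq> mag_paths G 3 4" "Poly_Mapping.keys y \<subseteq> mag_paths G 3 4" for x y
    using h.hom_mult[of x y] that by (simp add: mag_chain_group_def)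
  have hd: "h (x - y) = h x \<otimes>\<^bsub>M\<^esub> inv\<^bsub>M\<^esub> h y"
    if "Poly_Mapping.keys x \<subseteq> mag_paths G 3 4" "Poly_Mapping.keys y \<subseteq> mag_paths G 3 4" for x y
    using ha[of x "- y"] hm[of y] that by simp
  have hc: "h x \<in> carrier M" if "Poly_Mapping.keys x \<subseteq> mag_paths G 3 4" for x
    using that by simp
  have kd: "Poly_Mapping.keys (x - y) \<subseteq> P" if "Poly_Mapping.keys x \<subseteq> P" "Poly_Mapping.keys y \<subseteq> P"
    for x y :: "'a list \<Rightarrow>\<^sub>0 int" and P
    using that by (intro order_trans[OF keys_diff] Un_least)
  have bd_keys: "Poly_Mapping.keys (mag_boundary G 4 4 c) \<subseteq> mag_paths G 3 4"
    if "Poly_Mapping.keys c \<subseteq> mag_paths G 4 4" for c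
    using hom_in_carrier[OF mag_boundary_hom[of G 3 4], of c] that
    by (simp add: mag_chain_group_def)
  have gen: "h (mag_boundary G 4 4 (frag_of xs)) = \<one>\<^bsub>M\<^esub>" if xs: "xs \<in> mag_paths G 4 4" for xs
  proof (cases "xs ! 0 = s \<and> xs ! 4 = t")
    case True
    then obtain a b c where abc: "xs = [s, a, b, c, t]" "flag a b c"
      using path_4_4_flag[OF xs] by blast
    note p = flag_paths[OF abc(2)]
    have "h (mag_boundary G 4 4 (frag_of xs)) = w a c \<otimes>\<^bsub>M\<^esub> inv\<^bsub>M\<^esub> w b c \<otimes>\<^bsub>M\<^esub> inv\<^bsub>M\<^esub> w a b"
      using p by (simp add: abc flag_boundary hd kd keys_frag_of hf)
    also have "\<dots> = \<one>\<^bsub>M\<^esub>"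
      using w by (simp add: cocycle[OF abc(2)] M.m_assoc)
    finally show ?thesis .
  next
    case False
    \<comment> \<open>Only inner entries are deleted, so no face acquires the end points
      \<open>s\<close> and \<open>t\<close>.\<close>
    have face: "h (mag_face G 4 4 i xs) = \<one>\<^bsub>M\<^esub> \<and>
        Poly_Mapping.keys (mag_face G 4 4 i xs) \<subseteq> mag_paths G 3 4" if "i \<in> {1, 2, 3}" for i
    proof (cases "delete_nth i xs \<in> mag_paths G 3 4")
      case True
      have "length xs = 5" using xs by (simp add: mag_paths_def mag_path_def)
      then obtain a b c d e where "xs = [a, b, c, d, e]"
        by (auto simp: length_Suc_conv numeral_eq_Suc)
      with False that have "\<not> (delete_nth i xs ! 0 = s \<and> delete_nth i xs ! 3 = t)"
        by (auto simp: delete_nth_def numeral_eq_Suc)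
      with True show ?thesis by (auto simp: mag_face_def hf keys_frag_of)
    next
      case False
      then show ?thesis by (simp add: mag_face_def h0)
    qed
    have "{1..<4::nat} = {1, 2, 3}" by auto
    then have "mag_boundary G 4 4 (frag_of xs) =
        mag_face G 4 4 2 xs - mag_face G 4 4 3 xs - mag_face G 4 4 1 xs"
      by (simp add: mag_boundary_def)
    then show ?thesis using face by (simp add: hd kd)
  qed
  have "h (mag_boundary G 4 4 c) = \<one>\<^bsub>M\<^esub>" if "Poly_Mapping.keys c \<subseteq> mag_paths G 4 4" for c
    by (rule free_Abelian_group_induct[OF that]) (simp_all add: h0 gen mag_boundary_diff hd bd_keys)
  then have "h c = \<one>\<^bsub>M\<^esub>" if "c \<in> mag_boundaries G 3 4" for c
    using that by (auto simp: mag_boundaries_def mag_chain_group_def)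
  moreover have "h (frag_of [s, x, y, t]) = w x y" if "[s, x, y, t] \<in> mag_paths G 3 4" for x y
    using hf[OF that] by (simp add: numeral_eq_Suc)
  ultimately show ?thesis using that h by blast
qed

section \<open>The labelled triangle complex\<close>

datatype cell = Bot | Top | Vert nat | Edge nat nat | Tri nat nat

text \<open>Countability provides \<open>to_nat\<close>, which turns cells into vertices that are
  natural numbers.\<close>

instance cell :: countable
  by countable_datatype

fun cell_rank :: "cell \<Rightarrow> int" where
  "cell_rank Bot = 0"
| "cell_rank (Vert i) = 1"
| "cell_rank (Edge k j) = 2"
| "cell_rank (Tri a b) = 3"
| "cell_rank Top = 4"

text \<open>The index \<open>k\<close> names a side of the triangle: 0 runs from 0 to 1, 1 from 1 to
  2, and 2 from 0 to 2.\<close>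

definition source :: "nat \<Rightarrow> nat" where "source k = (if k = 1 then 1 else 0)"

definition target :: "nat \<Rightarrow> nat" where "target k = (if k = 0 then 1 else 2)"

text \<open>Group elements are indexed through \<open>u\<close>, so that cells carry only natural
  numbers. The image of \<open>J\<close> is the generating set of the presentation.\<close>

locale triangle_complex = comm_group +
  fixes u :: "nat \<Rightarrow> 'a" and J :: "nat set"
  assumes u_closed [simp]: "u j \<in> carrier G"
    and u_inj: "inj_on u J"
    and finite_J: "finite J"
    and one_in: "\<one> \<in> u ` J"
begin

text \<open>
  \<open>Edge k j\<close> carries the group element \<open>u j\<close> and runs from \<open>Vert (source k)\<close> to \<open>Vert (target k)\<close>.
  \<open>Tri a b\<close> has the sides \<open>Edge 0 a\<close>, \<open>Edge 1 b\<close> and \<open>Edge 2 c\<close> with \<open>u c = u a \<otimes> u b\<close>.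
\<close>

definition cells :: "cell set" where
  "cells = {Bot, Top} \<union> Vert ` {..<3} \<union> (\<lambda>(k, j). Edge k j) ` ({..<3} \<times> J) \<union>
     (\<lambda>(a, b). Tri a b) ` {(a, b) \<in> J \<times> J. u a \<otimes> u b \<in> u ` J}"

text \<open>The covering relation of the face poset, directed upwards. The third side of a triangle
  is picked out by its label, and \<open>u_inj\<close> makes its index in \<open>J\<close>
  unique.\<close>

fun incident :: "cell \<Rightarrow> cell \<Rightarrow> bool" where
  "incident Bot (Vert i) = True"
| "incident (Vert i) (Edge k j) = (i = source k \<or> i = target k)"
| "incident (Edge k j) (Tri a b) =
    (k = 0 \<and> j = a \<or> k = 1 \<and> j = b \<or> k = 2 \<and> u j = u a \<otimes> u b)"
| "incident (Tri a b) Top = True"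
| "incident _ _ = False"

definition hasse :: "nat pair_pre_digraph" where
  "hasse = \<lparr>pverts = to_nat ` cells,
     parcs = {(to_nat x, to_nat y) | x y. x \<in> cells \<and> y \<in> cells \<and> (incident x y \<or> incident y x)}\<rparr>"

lemma parcs_hasse:
  "(m, n) \<in> parcs hasse \<longleftrightarrow>
     (\<exists>x \<in> cells. \<exists>y \<in> cells. m = to_nat x \<and> n = to_nat y \<and> (incident x y \<or> incident y x))"
  by (auto simp: hasse_def)

lemma finite_cells: "finite cells"
  unfolding cells_def using finite_J
  by (intro finite_UnI finite_imageI finite_SigmaI) (auto intro: finite_subset[of _ "J \<times> J"])

lemma mem_cells:
  "Bot \<in> cells" "Top \<in> cells" "Vert i \<in> cells \<longleftrightarrow> i < 3"
  "Edge k j \<in> cells \<longleftrightarrow> k < 3 \<and> j \<in> J"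
  "Tri a b \<in> cells \<longleftrightarrow> a \<in> J \<and> b \<in> J \<and> u a \<otimes> u b \<in> u ` J"
  by (auto simp: cells_def)

lemma incident_rank: "incident x y \<Longrightarrow> cell_rank y = cell_rank x + 1"
  by (induction x y rule: incident.induct) auto

lemma pair_graph_hasse: "pair_graph hasse"
proof
  show "finite (pverts hasse)" using finite_cells by (simp add: hasse_def)
  have "parcs hasse \<subseteq> to_nat ` cells \<times> to_nat ` cells" by (auto simp: hasse_def)
  then show "finite (parcs hasse)" by (rule finite_subset) (simp add: finite_cells)
  show "symmetric (with_proj hasse)"
    by (auto simp: symmetric_def sym_def hasse_def)
  show "fst e \<noteq> snd e" if "e \<in> parcs hasse" for e
    using that incident_rank by (force simp: hasse_def)
qed (auto simp: hasse_def)

sublocale L: layered_graph hasse "\<lambda>m. cell_rank (from_nat m)" "to_nat Bot" "to_nat Top"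
proof -
  interpret pair_graph hasse by (rule pair_graph_hasse)
  show "layered_graph hasse (\<lambda>m. cell_rank (from_nat m)) (to_nat Bot) (to_nat Top)"
    by unfold_locales (auto simp: hasse_def mem_cells dest: incident_rank)
qed

text \<open>Arcs exist in both directions, but incidence raises the rank, which rules out the
  downward one.\<close>

lemma cover_iff:
  "L.cover (to_nat x) m \<longleftrightarrow> x \<in> cells \<and> (\<exists>y \<in> cells. m = to_nat y \<and> incident x y)"
  unfolding L.cover_def by (auto simp: parcs_hasse dest: incident_rank)

lemma flag_iff: "L.flag m1 m2 m3 \<longleftrightarrow> (\<exists>i k j a b. m1 = to_nat (Vert i) \<and> m2 = to_nat (Edge k j) \<and>
    m3 = to_nat (Tri a b) \<and> i < 3 \<and> k < 3 \<and> j \<in> J \<and> Tri a b \<in> cells \<and>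
    incident (Vert i) (Edge k j) \<and> incident (Edge k j) (Tri a b))" (is "?L \<longleftrightarrow> ?R")
proof
  assume ?L
  then obtain x y z where xyz: "m1 = to_nat x" "m2 = to_nat y" "m3 = to_nat z"
    "x \<in> cells" "y \<in> cells" "z \<in> cells" "incident Bot x" "incident x y" "incident y z"
    by (auto simp: L.flag_def cover_iff)
  obtain i where "x = Vert i" using xyz(7) by (cases x) auto
  moreover from this obtain k j where "y = Edge k j" using xyz(8) by (cases y) auto
  moreover from this obtain a b where "z = Tri a b" using xyz(9) by (cases z) auto
  ultimately show ?R using xyz by (auto simp: mem_cells)
next
  assume ?R
  then show ?L by (auto simp: L.flag_def cover_iff mem_cells)
qed

text \<open>
  The holonomy of the labelling by group elements along a flag, where every cell is placed at its
  least vertex.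
\<close>

fun weight :: "cell \<Rightarrow> cell \<Rightarrow> 'a" where
  "weight (Vert i) (Edge k j) = (if i = source k then \<one> else inv (u j))"
| "weight (Edge k j) (Tri a b) = (if k = 1 then inv (u a) else \<one>)"
| "weight (Vert i) (Tri a b) = (if i = 0 then \<one> else if i = 1 then inv (u a) else inv (u a \<otimes> u b))"
| "weight _ _ = \<one>"

lemma weight_closed: "weight x y \<in> carrier G"
  by (induction x y rule: weight.induct) auto

text \<open>A check over the six flags of a triangle. Moving from a vertex to the triangle directly
  or through an edge gives the same holonomy; for the side \<open>k = 2\<close> this is the equation
  \<open>u j = u a \<otimes> u b\<close>.\<close>

lemma weight_cocycle:
  assumes "L.flag m1 m2 m3"
  shows "weight (from_nat m1) (from_nat m3) =
    weight (from_nat m1) (from_nat m2) \<otimes> weight (from_nat m2) (from_nat m3)"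
  using assms by (auto simp: flag_iff source_def target_def inv_mult m_comm)

section \<open>Edge chains, triangle boundaries and loops\<close>

definition half :: "nat \<Rightarrow> nat \<Rightarrow> nat \<Rightarrow> (nat list \<Rightarrow>\<^sub>0 int)" where
  "half i k j = frag_of [to_nat Bot, to_nat (Vert i), to_nat (Edge k j), to_nat Top]"

text \<open>In the barycentric subdivision \<open>half i k j\<close> joins \<open>Vert i\<close> to
  the midpoint of the edge. In the difference of the two halves the midpoint cancels from the
  boundary, leaving the source minus the target.\<close>

definition edge :: "nat \<Rightarrow> nat \<Rightarrow> (nat list \<Rightarrow>\<^sub>0 int)" where
  "edge k j = half (source k) k j - half (target k) k j"

text \<open>The triangle is the signed sum of the six flags of its barycentric subdivision.\<close>

lemma triangle_boundary:
  assumes "a \<in> J" "b \<in> J" "c \<in> J" "u c = u a \<otimes> u b"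
  shows "edge 0 a + edge 1 b - edge 2 c \<in> mag_boundaries hasse 3 4"
proof -
  let ?F = "\<lambda>i k j. [to_nat Bot, to_nat (Vert i), to_nat (Edge k j), to_nat (Tri a b), to_nat Top]"
  let ?D = "\<lambda>i k j. frag_of (?F i k j)"
  let ?V = "\<lambda>i. frag_of [to_nat Bot, to_nat (Vert i), to_nat (Tri a b), to_nat Top]"
  let ?E = "\<lambda>k j. frag_of [to_nat Bot, to_nat (Edge k j), to_nat (Tri a b), to_nat Top]"
  \<comment> \<open>The signs alternate around the triangle, so each inner face \<open>?V i\<close>
    or \<open>?E k j\<close> occurs twice with opposite signs and only the half edges on the rim
    survive.\<close>
  define D where "D = ?D 1 0 a - ?D 0 0 a + ?D 2 1 b - ?D 1 1 b + ?D 0 2 c - ?D 2 2 c"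
  have "u a \<otimes> u b \<in> u ` J" using assms by (metis imageI)
  then have fl: "L.flag (to_nat (Vert i)) (to_nat (Edge k j)) (to_nat (Tri a b))"
    if "(i, k, j) \<in> {(0, 0, a), (1, 0, a), (1, 1, b), (2, 1, b), (0, 2, c), (2, 2, c)}" for i k j
    using that assms by (auto simp: flag_iff mem_cells source_def target_def)
  have bd: "mag_boundary hasse 4 4 (?D i k j) = ?V i - ?E k j - half i k j"
    and path: "?F i k j \<in> mag_paths hasse 4 4"
    if "(i, k, j) \<in> {(0, 0, a), (1, 0, a), (1, 1, b), (2, 1, b), (0, 2, c), (2, 2, c)}" for i k j
    using L.flag_boundary(1)[OF fl[OF that]] L.flag_paths(1)[OF fl[OF that]] by (simp_all add: half_def)
  have "Poly_Mapping.keys D \<subseteq> mag_paths hasse 4 4"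
    unfolding D_def using path
    by (intro order_trans[OF keys_diff] order_trans[OF keys_add] Un_least) (simp_all add: keys_frag_of)
  then have "D \<in> carrier (mag_chain_group hasse (Suc 3) 4)" by (simp add: mag_chain_group_def)
  moreover have "mag_boundary hasse (Suc 3) 4 D = edge 0 a + edge 1 b - edge 2 c"
    by (simp add: D_def mag_boundary_diff mag_boundary_add bd edge_def source_def target_def)
  ultimately show ?thesis unfolding mag_boundaries_def by (metis imageI)
qed

definition base :: nat where "base = inv_into J u \<one>"

lemma base: "base \<in> J" "u base = \<one>"
  using one_in by (auto simp: base_def inv_into_into f_inv_into_f)

text \<open>As \<open>u base = \<one>\<close>, the triangle \<open>Tri j base\<close> exists and has
  \<open>Edge 0 j\<close> as a side. Every half edge of type 0 thus extends to a flag, which makes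
  the results on flags available for it.\<close>

lemma edge_flag:
  assumes "j \<in> J" "i \<in> {0, 1}"
  shows "L.flag (to_nat (Vert i)) (to_nat (Edge 0 j)) (to_nat (Tri j base))"
  using assms base by (auto simp: flag_iff mem_cells source_def target_def)

lemma edge_cycle:
  assumes "j \<in> J"
  shows "edge 0 j \<in> carrier (mag_chain_group hasse 3 4)"
    "mag_boundary hasse 3 4 (edge 0 j) = frag_of [to_nat Bot, to_nat (Vert 0), to_nat Top] -
       frag_of [to_nat Bot, to_nat (Vert 1), to_nat Top]"
proof -
  note fl = edge_flag[OF assms, of 0] edge_flag[OF assms, of 1]
  show "edge 0 j \<in> carrier (mag_chain_group hasse 3 4)"
    unfolding mag_chain_group_def carrier_free_Abelian_group_iff edge_def half_def
    using fl[THEN L.flag_paths(4)]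
    by (intro order_trans[OF keys_diff] Un_least) (simp_all add: keys_frag_of source_def target_def)
  show "mag_boundary hasse 3 4 (edge 0 j) = frag_of [to_nat Bot, to_nat (Vert 0), to_nat Top] -
       frag_of [to_nat Bot, to_nat (Vert 1), to_nat Top]"
    using fl[THEN L.flag_boundary(2)]
    by (simp add: edge_def half_def source_def target_def mag_boundary_diff)
qed

text \<open>Along the edge labelled \<open>x\<close> from \<open>Vert 0\<close> to
  \<open>Vert 1\<close>, and back along the parallel edge labelled \<open>\<one>\<close>.\<close>

definition loop :: "'a \<Rightarrow> (nat list \<Rightarrow>\<^sub>0 int)" where
  "loop x = edge 0 (inv_into J u x) - edge 0 base"

lemma loop_cycle: "x \<in> u ` J \<Longrightarrow> loop x \<in> mag_cycles hasse 3 4"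
  using edge_cycle[OF inv_into_into[of x u J]] edge_cycle[OF base(1)]
    order_trans[OF keys_diff Un_least, of "edge 0 (inv_into J u x)" "mag_paths hasse 3 4" "edge 0 base"]
  by (simp add: loop_def mag_cycles_def mag_boundary_diff mag_chain_group_def)

text \<open>The triangle for \<open>x \<otimes> y\<close> involves edges of types 1 and 2. Three
  triangles with one side labelled \<open>\<one>\<close> trade these for edges of type 0: in the
  alternating sum of the four boundaries all other types cancel.\<close>

lemma loop_rel:
  assumes "x \<in> u ` J" "y \<in> u ` J" "x \<otimes> y \<in> u ` J"
  shows "loop x + loop y - loop (x \<otimes> y) \<in> mag_boundaries hasse 3 4"
proof -
  obtain a b c where abc: "a \<in> J" "b \<in> J" "c \<in> J" "x = u a" "y = u b" "x \<otimes> y = u c"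
    using assms by blast
  have ix: "inv_into J u x = a" "inv_into J u y = b" "inv_into J u (x \<otimes> y) = c"
    using abc u_inj by (simp_all add: inv_into_f_f)
  let ?R = "\<lambda>a b c. edge 0 a + edge 1 b - edge 2 c"
  have R: "?R a b c \<in> mag_boundaries hasse 3 4" "?R base b b \<in> mag_boundaries hasse 3 4"
    "?R b base b \<in> mag_boundaries hasse 3 4" "?R c base c \<in> mag_boundaries hasse 3 4"
    using abc base by (auto intro!: triangle_boundary simp del: One_nat_def)
  have "?R a b c - ?R base b b + ?R b base b - ?R c base c \<in> mag_boundaries hasse 3 4"
    by (rule mag_boundaries_diff[OF mag_boundaries_add[OF mag_boundaries_diff[OF R(1,2)] R(3)] R(4)])
  also have "?R a b c - ?R base b b + ?R b base b - ?R c base c = loop x + loop y - loop (x \<otimes> y)"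
    by (simp add: loop_def ix)
  finally show ?thesis .
qed

lemma loop_triangle_rels:
  "c \<in> triangle_rels G (u ` J) \<Longrightarrow> frag_extend loop c \<in> mag_boundaries hasse 3 4"
proof (induction rule: triangle_rels.induct)
  case zero
  show ?case
    using subgroup.one_closed[OF subgroup_mag_boundaries, of hasse 3 4] by (simp add: mag_chain_group_def)
next
  case (rel a b)
  then show ?case using loop_rel by (simp add: frag_extend_diff frag_extend_add)
next
  case (diff x y)
  then show ?case by (simp add: frag_extend_diff mag_boundaries_diff)
qed

lemma frag_loop_cycle:
  assumes "Poly_Mapping.keys c \<subseteq> u ` J"
  shows "frag_extend loop c \<in> mag_cycles hasse 3 4"
proof (rule free_Abelian_group_induct[OF assms])
  show "frag_extend loop 0 \<in> mag_cycles hasse 3 4"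
    using subgroup.one_closed[OF subgroup_mag_cycles, of hasse 3 4] by (simp add: mag_chain_group_def)
next
  fix x y
  assume "frag_extend loop x \<in> mag_cycles hasse 3 4" "frag_extend loop y \<in> mag_cycles hasse 3 4"
  then show "frag_extend loop (x - y) \<in> mag_cycles hasse 3 4"
    unfolding mag_cycles_def mag_chain_group_def
    by (auto simp: frag_extend_diff mag_boundary_diff dest!: subsetD[OF keys_diff])
qed (simp add: loop_cycle)

text \<open>If the value is \<open>\<one>\<close>, the presentation writes \<open>c\<close> by
  relations, which bound. Conversely, the homomorphism given by \<open>weight\<close> kills
  boundaries and sends \<open>loop x\<close> to \<open>x\<close>, so on looped sums it agrees with
  \<open>frag_eval\<close>.\<close>

lemma loop_boundary_iff:
  assumes pres: "presented_by (u ` J)" and c: "Poly_Mapping.keys c \<subseteq> u ` J"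
  shows "frag_extend loop c \<in> mag_boundaries hasse 3 4 \<longleftrightarrow> frag_eval c = \<one>"
proof
  assume "frag_eval c = \<one>"
  then have "c \<in> triangle_rels G (u ` J)" using pres c by (simp add: presented_by_def)
  then show "frag_extend loop c \<in> mag_boundaries hasse 3 4" by (rule loop_triangle_rels)
next
  assume bd: "frag_extend loop c \<in> mag_boundaries hasse 3 4"
  let ?w = "\<lambda>m n. weight (from_nat m) (from_nat n)"
  obtain h where h: "h \<in> hom (mag_chain_group hasse 3 4) G"
    and hw: "\<And>x y. [to_nat Bot, x, y, to_nat Top] \<in> mag_paths hasse 3 4 \<Longrightarrow>
      h (frag_of [to_nat Bot, x, y, to_nat Top]) = ?w x y"
    and hb: "\<And>c. c \<in> mag_boundaries hasse 3 4 \<Longrightarrow> h c = \<one>"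
    using L.cocycle_hom[OF comm_group_axioms, of ?w] weight_closed weight_cocycle by metis
  interpret h: group_hom "mag_chain_group hasse 3 4" G h
    using h by (simp add: group_hom_def group_hom_axioms_def group_mag_chain_group)
  have hd: "h (x - y) = h x \<otimes> inv (h y)"
    if "x \<in> carrier (mag_chain_group hasse 3 4)" "y \<in> carrier (mag_chain_group hasse 3 4)" for x y
    using h.hom_mult[of x "- y"] h.hom_inv[of y] that by (simp add: mag_chain_group_def)
  have he: "h (edge 0 j) = u j" if j: "j \<in> J" for j
  proof -
    note p = edge_flag[OF j, of 0, THEN L.flag_paths(4)] edge_flag[OF j, of 1, THEN L.flag_paths(4)]
    \<comment> \<open>The half at \<open>Vert 0\<close> has weight \<open>\<one>\<close> and the
      half at \<open>Vert 1\<close> has weight \<open>inv (u j)\<close>, so the quotient is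
      \<open>u j\<close>.\<close>
    have "h (edge 0 j) = h (half 0 0 j) \<otimes> inv (h (half 1 0 j))"
      using p by (simp add: edge_def source_def target_def hd half_def mag_chain_group_def)
    also have "\<dots> = u j" using p by (simp add: half_def hw source_def)
    finally show ?thesis .
  qed
  have hl: "h (loop x) = x" if "x \<in> u ` J" for x
    using that base inv_into_into[of x u J]
    by (auto simp: loop_def hd edge_cycle he f_inv_into_f)
  have "h (frag_extend loop c) = frag_eval c"
  proof (rule free_Abelian_group_induct[OF c])
    show "h (frag_extend loop 0) = frag_eval 0"
      using h.hom_one by (simp add: mag_chain_group_def)
  next
    fix x y
    assume xy: "Poly_Mapping.keys x \<subseteq> u ` J" "Poly_Mapping.keys y \<subseteq> u ` J"
      "h (frag_extend loop x) = frag_eval x" "h (frag_extend loop y) = frag_eval y"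
    have "Poly_Mapping.keys x \<subseteq> carrier G" "Poly_Mapping.keys y \<subseteq> carrier G" using xy(1,2) by auto
    moreover have "frag_extend loop x \<in> carrier (mag_chain_group hasse 3 4)"
      "frag_extend loop y \<in> carrier (mag_chain_group hasse 3 4)"
      using xy(1,2)[THEN frag_loop_cycle] by (simp_all add: mag_cycles_def)
    ultimately show "h (frag_extend loop (x - y)) = frag_eval (x - y)"
      using xy(3,4) by (simp add: frag_extend_diff hd frag_eval_diff)
  qed (use hl in auto)
  then show "frag_eval c = \<one>" using hb[OF bd] by simp
qed

text \<open>The free abelian group on the labels maps to the homology by loops and onto the group by
  evaluation. Both maps have the same kernel by \<open>loop_boundary_iff\<close>.\<close>

lemma magnitude_homology_subgroup:
  assumes pres: "presented_by (u ` J)" and gen: "generate G (u ` J) = carrier G"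
  shows "\<exists>H. subgroup H (magnitude_homology hasse) \<and>
     (magnitude_homology hasse)\<lparr>carrier := H\<rparr> \<cong> G"
proof -
  let ?F = "free_Abelian_group (u ` J)" and ?C = "mag_chain_group hasse 3 4"
    and ?B = "mag_boundaries hasse 3 4"
  let ?A = "\<lambda>(k, l). mag_homology_group hasse k l"
  let ?q = "\<lambda>c. ?B #>\<^bsub>?C\<^esub> frag_extend loop c"
  \<comment> \<open>The class of the looped sum is placed in bidegree \<open>(3, 4)\<close>, with
    trivial components elsewhere.\<close>
  define f where "f = (\<lambda>x. \<lambda>i\<in>UNIV. if i = (3, 4) then x else \<one>\<^bsub>?A i\<^esub>) \<circ> ?q"
  have grp: "group (?A i)" for i by (cases i) (simp add: group_mag_homology_group)
  have carr: "frag_extend loop c \<in> carrier ?C" if "c \<in> carrier ?F" for c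
    using frag_loop_cycle[of c] that by (simp add: mag_cycles_def)
  have "frag_extend loop \<in> hom ?F ?C"
    using carr by (auto simp: hom_def mag_chain_group_def frag_extend_add)
  then have "?q \<in> hom ?F (mag_homology_group hasse 3 4)"
    by (rule mag_class_hom) (use frag_loop_cycle in auto)
  then have "f \<in> hom ?F (magnitude_homology hasse)"
    unfolding f_def magnitude_homology_def
    using Group.hom_compose[OF _ sum_group_single_hom[of UNIV ?A "(3, 4)"]] grp by simp
  then have f: "group_hom ?F (magnitude_homology hasse) f"
    using grp by (simp add: group_hom_def group_hom_axioms_def magnitude_homology_def)
  have g: "group_hom ?F G frag_eval"
  proof -
    have "frag_eval \<in> hom ?F G"
    proof (rule homI)
      fix x y assume "x \<in> carrier ?F" "y \<in> carrier ?F"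
      then have "Poly_Mapping.keys x \<subseteq> carrier G" "Poly_Mapping.keys y \<subseteq> carrier G" by auto
      then show "frag_eval (x \<otimes>\<^bsub>?F\<^esub> y) = frag_eval x \<otimes> frag_eval y"
        by (simp add: frag_eval_add)
    qed (auto intro!: frag_eval_closed)
    then show ?thesis by (simp add: group_hom_def group_hom_axioms_def is_group)
  qed
  have "u ` J \<subseteq> frag_eval ` carrier ?F"
  proof
    fix x assume "x \<in> u ` J"
    then have "frag_eval (frag_of x) = x" "frag_of x \<in> carrier ?F" by auto
    then show "x \<in> frag_eval ` carrier ?F" by (metis imageI)
  qed
  then have surj: "frag_eval ` carrier ?F = carrier G"
    using generate_subgroup_incl[OF _ group_hom.img_is_subgroup[OF g]] gen
      subgroup.subset[OF group_hom.img_is_subgroup[OF g]] by blast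
  have "f c = \<one>\<^bsub>magnitude_homology hasse\<^esub> \<longleftrightarrow> frag_eval c = \<one>" if c: "c \<in> carrier ?F" for c
  proof -
    \<comment> \<open>Only the component at \<open>(3, 4)\<close> can be nontrivial, and the
      identity of that quotient is the coset \<open>?B\<close>.\<close>
    have "f c = \<one>\<^bsub>magnitude_homology hasse\<^esub> \<longleftrightarrow> ?q c = ?B"
      by (auto simp: f_def magnitude_homology_def fun_eq_iff mag_homology_group_def FactGroup_def)
    also have "\<dots> \<longleftrightarrow> frag_extend loop c \<in> ?B"
      using group.coset_join1[OF group_mag_chain_group _ carr[OF c] subgroup_mag_boundaries]
        group.coset_join2[OF group_mag_chain_group carr[OF c] subgroup_mag_boundaries] by blast
    also have "\<dots> \<longleftrightarrow> frag_eval c = \<one>"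
      using loop_boundary_iff[OF pres] c by simp
    finally show ?thesis .
  qed
  then have "kernel ?F (magnitude_homology hasse) f = kernel ?F G frag_eval"
    by (auto simp: kernel_def)
  from subgroup_iso_of_kernel_eq[OF f g surj this] show ?thesis .
qed

end

theorem theorem3p14:
  fixes M :: "('a, 'b) monoid_scheme"
  assumes "comm_group M"
    and "\<exists>S \<subseteq> carrier M. finite S \<and> generate M S = carrier M"
  shows "\<exists>G :: nat pair_pre_digraph. pair_graph G \<and>
           (\<exists>H. subgroup H (magnitude_homology G) \<and>
                (magnitude_homology G)\<lparr>carrier := H\<rparr> \<cong> M)"
proof -
  interpret comm_group M by (rule assms(1))
  obtain S where S: "S \<subseteq> carrier M" "finite S" "generate M S = carrier M" using assms(2) by blast
  obtain F where F: "presented_by F" "S \<subseteq> F" using finitely_generated_presented[OF S(2,1)] by blast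
  have Fc: "F \<subseteq> carrier M" "finite F" "\<one>\<^bsub>M\<^esub> \<in> F" using F(1) by (auto simp: presented_by_def)
  have gen: "generate M F = carrier M"
    using mono_generate[OF F(2)] S(3) generate_incl[OF Fc(1)] by auto
  obtain e where e: "bij_betw e {0..<card F} F"
    using ex_bij_betw_nat_finite[OF Fc(2)] by blast
  \<comment> \<open>The default \<open>\<one>\<close> outside the index range keeps
    \<open>u j\<close> in the carrier for every \<open>j\<close>, as the locale demands.\<close>
  define u where "u j = (if j < card F then e j else \<one>\<^bsub>M\<^esub>)" for j
  have uF: "u ` {0..<card F} = F" using e by (auto simp: u_def bij_betw_def)
  interpret triangle_complex M u "{0..<card F}"
  proof
    show "u j \<in> carrier M" for j
      using uF Fc(1) by (cases "j < card F") (auto simp: u_def)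
    show "inj_on u {0..<card F}"
      using e by (auto simp: u_def bij_betw_def inj_on_def)
  qed (use uF Fc(3) in auto)
  show ?thesis
    using magnitude_homology_subgroup pair_graph_hasse F(1) gen by (auto simp: uF)
qed

end
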